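(* Let $s$ be an even integer, let $t$ be any integer, and let $n$ be a non-negative integer. Then $$\sum_{k=0}^n \binom{n}{k} \frac{1}{k+2} (-1)^{k} L_s^{n-k} F_{2s(k+2)+s(n-k)+t} = \frac{1}{(n+1)(n+2)}\Big( L_s^{n+2} F_{s(n+2)+t} - F_t \Big) - \frac{1}{n+1} F_{2s+t}$$ and $$\sum_{k=0}^n \binom{n}{k} \frac{1}{k+2} (-1)^{k} L_s^{n-k} L_{2s(k+2)+s(n-k)+t} = \frac{1}{(n+1)(n+2)}\Big( L_s^{n+2} L_{s(n+2)+t} - L_t \Big) - \frac{1}{n+1} L_{2s+t}.$$
   Context: $F_m$ and $L_m$ denote the Fibonacci and Lucas numbers, defined for all integers $m$ by the recurrence $x_m = x_{m-1}+x_{m-2}$ with $F_0=0$, $F_1=1$ and $L_0=2$, $L_1=1$. In particular $F_{-m}=(-1)^{m-1}F_m$ and $L_{-m}=(-1)^m L_m$. *)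

theory Defs
  imports Complex_Main "HOL-Number_Theory.Fib"
begin

text \<open>The recurrence \<open>x m = x (m - 1) + x (m - 2)\<close> is run upwards from \<open>0, 1\<close> for
  positive indices, and downwards, as \<open>x m = x (m + 2) - x (m + 1)\<close>, for negative ones.\<close>

function fib_int :: "int \<Rightarrow> int" where
  "fib_int m =
    (if m = 0 then 0
     else if m = 1 then 1
     else if m > 1 then fib_int (m - 1) + fib_int (m - 2)
     else fib_int (m + 2) - fib_int (m + 1))"
  by pat_completeness auto
termination by (relation "measure (\<lambda>m. nat \<bar>2 * m - 1\<bar>)") auto

function lucas_int :: "int \<Rightarrow> int" where
  "lucas_int m =
    (if m = 0 then 2
     else if m = 1 then 1
     else if m > 1 then lucas_int (m - 1) + lucas_int (m - 2)
     else lucas_int (m + 2) - lucas_int (m + 1))"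
  by pat_completeness auto
termination by (relation "measure (\<lambda>m. nat \<bar>2 * m - 1\<bar>)") auto

declare fib_int.simps [simp del] lucas_int.simps [simp del]

lemma fib_int_0 [simp]: "fib_int 0 = 0"
  and fib_int_1 [simp]: "fib_int 1 = 1"
  by (simp_all add: fib_int.simps)

lemma lucas_int_0 [simp]: "lucas_int 0 = 2"
  and lucas_int_1 [simp]: "lucas_int 1 = 1"
  by (simp_all add: lucas_int.simps)

lemma fib_int_rec: "fib_int m = fib_int (m - 1) + fib_int (m - 2)"
proof (cases "m > 1")
  case True
  then show ?thesis by (subst fib_int.simps) simp
next
  case False
  then have "fib_int (m - 2) = fib_int m - fib_int (m - 1)"
    by (subst fib_int.simps) (simp add: algebra_simps)
  then show ?thesis by simp
qed

lemma lucas_int_rec: "lucas_int m = lucas_int (m - 1) + lucas_int (m - 2)"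
proof (cases "m > 1")
  case True
  then show ?thesis by (subst lucas_int.simps) simp
next
  case False
  then have "lucas_int (m - 2) = lucas_int m - lucas_int (m - 1)"
    by (subst lucas_int.simps) (simp add: algebra_simps)
  then show ?thesis by simp
qed

lemma fib_int_of_nat: "fib_int (int n) = int (fib n)"
proof (induction n rule: fib.induct)
  case (3 n)
  have "fib_int (int (Suc (Suc n))) = fib_int (int (Suc n)) + fib_int (int n)"
    using fib_int_rec[of "int (Suc (Suc n))"] by simp
  with 3 show ?case by simp
qed simp_all

lemma fib_int_uminus_of_nat: "fib_int (- int n) = (- 1) ^ Suc n * fib_int (int n)"
proof (induction n rule: fib.induct)
  case (3 n)
  have shift: "- int n - 1 = - int (Suc n)" "- int n - 2 = - int (Suc (Suc n))"
    by simp_all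
  have "fib_int (- int n) = fib_int (- int (Suc n)) + fib_int (- int (Suc (Suc n)))"
    by (rule fib_int_rec[of "- int n", unfolded shift])
  moreover have "fib_int (int (Suc (Suc n))) = fib_int (int (Suc n)) + fib_int (int n)"
    using fib_int_rec[of "int (Suc (Suc n))"] by simp
  ultimately show ?case using 3 by (simp add: algebra_simps)
qed (simp_all add: fib_int.simps[of "- 1"])

lemma lucas_int_uminus_of_nat: "lucas_int (- int n) = (- 1) ^ n * lucas_int (int n)"
proof (induction n rule: fib.induct)
  case (3 n)
  have shift: "- int n - 1 = - int (Suc n)" "- int n - 2 = - int (Suc (Suc n))"
    by simp_all
  have "lucas_int (- int n) = lucas_int (- int (Suc n)) + lucas_int (- int (Suc (Suc n)))"
    by (rule lucas_int_rec[of "- int n", unfolded shift])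
  moreover have "lucas_int (int (Suc (Suc n))) = lucas_int (int (Suc n)) + lucas_int (int n)"
    using lucas_int_rec[of "int (Suc (Suc n))"] by simp
  ultimately show ?case using 3 by (simp add: algebra_simps)
qed (simp_all add: lucas_int.simps[of "- 1"])

end

theory Submission
  imports Defs
begin

text \<open>Let \<open>G\<close> be \<open>F\<close> or the Lucas sequence, \<open>L = L\<^sub>s\<close> and \<open>v j = G (s j + t)\<close>, and let \<open>E\<close> be the
  shift of \<open>v\<close>. As \<open>s\<close> is even, \<open>(L - E) E = 1\<close>. Since \<open>(n + 1) (n + 2) / (k + 2)\<close> times
  \<open>n choose k\<close> is \<open>k + 1\<close> times \<open>(n + 2) choose (k + 2)\<close>, with \<open>N = n + 2\<close> and \<open>j = k + 2\<close> the
  sum becomes \<open>1 / ((n + 1) (n + 2))\<close> times that of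
  \<open>(j - 1) (N choose j) (-1)\<^sup>j L\<^sup>N\<^sup>-\<^sup>j v (N + j)\<close> over \<open>j \<ge> 2\<close>. The binomial expansions of
  \<open>(L - E)\<^sup>N E\<^sup>N\<close> and \<open>- N E (L - E)\<^sup>N\<^sup>-\<^sup>1 E\<^sup>N\<close> evaluate the full sum over \<open>j \<ge> 0\<close>, whose
  terms at \<open>0\<close> and \<open>1\<close> are \<open>- L\<^sup>N v N\<close> and \<open>0\<close>.\<close>

text \<open>Pascal's rule, regrouped by \<open>N choose j\<close>; the extra term at
  \<open>Suc N\<close> vanishes.\<close>

lemma sum_choose_Suc:
  fixes f :: "nat \<Rightarrow> 'a::comm_ring_1"
  shows "(\<Sum>j\<le>Suc N. of_nat (Suc N choose j) * f j)
    = (\<Sum>j\<le>N. of_nat (N choose j) * (f j + f (Suc j)))"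
proof -
  have "(\<Sum>j\<le>Suc N. of_nat (Suc N choose j) * f j)
      = f 0 + (\<Sum>j\<le>N. of_nat (N choose Suc j) * f (Suc j))
        + (\<Sum>j\<le>N. of_nat (N choose j) * f (Suc j))"
    unfolding sum.atMost_Suc_shift by (simp add: sum.distrib algebra_simps)
  also have "f 0 + (\<Sum>j\<le>N. of_nat (N choose Suc j) * f (Suc j))
      = (\<Sum>j\<le>Suc N. of_nat (N choose j) * f j)"
    unfolding sum.atMost_Suc_shift by simp
  also have "\<dots> = (\<Sum>j\<le>N. of_nat (N choose j) * f j)"
    by (simp add: binomial_eq_0)
  finally show ?thesis
    by (simp add: sum.distrib algebra_simps)
qed

text \<open>Absorption \<open>j * (Suc N choose j) = Suc N * (N choose (j - 1))\<close> for positive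
  \<open>j\<close>; the term at \<open>0\<close> drops out.\<close>

lemma sum_index_choose_Suc:
  fixes f :: "nat \<Rightarrow> 'a::comm_ring_1"
  shows "(\<Sum>j\<le>Suc N. of_nat j * of_nat (Suc N choose j) * f j)
    = of_nat (Suc N) * (\<Sum>j\<le>N. of_nat (N choose j) * f (Suc j))"
proof -
  have "of_nat (Suc j) * of_nat (Suc N choose Suc j)
      = (of_nat (Suc N) * of_nat (N choose j) :: 'a)" for j
    by (metis Suc_times_binomial_eq mult.commute of_nat_mult)
  then show ?thesis
    unfolding sum.atMost_Suc_shift sum_distrib_left
    by (simp add: mult.assoc del: of_nat_Suc binomial_Suc_Suc)
qed

text \<open>This is \<open>(L - E)^N E^N = 1\<close> applied to \<open>v\<close> at
  \<open>m\<close>. Pascal's rule pairs neighbouring terms, and each pair is one factor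
  \<open>L - E\<close>, which lowers the index by one.\<close>

lemma sum_choose_recurrence:
  fixes v :: "nat \<Rightarrow> 'a::comm_ring_1"
  assumes rec: "\<And>j. v (j + 2) = L * v (j + 1) - v j"
  shows "(\<Sum>j\<le>N. of_nat (N choose j) * ((-1) ^ j * L ^ (N - j) * v (m + N + j))) = v m"
proof (induction N)
  case (Suc N)
  have "v (m + N + j) = L * v (m + Suc N + j) - v (m + Suc N + Suc j)" for j
    using rec[of "m + N + j"] by simp
  \<comment> \<open>The bound on \<open>j\<close> gives
    \<open>L ^ (Suc N - j) = L * L ^ (N - j)\<close> despite truncated subtraction.\<close>
  then have "(-1) ^ j * L ^ (Suc N - j) * v (m + Suc N + j)
        + (-1) ^ Suc j * L ^ (Suc N - Suc j) * v (m + Suc N + Suc j)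
      = (-1) ^ j * L ^ (N - j) * v (m + N + j)" if "j \<le> N" for j
    using that by (simp add: Suc_diff_le right_diff_distrib mult.assoc mult.left_commute)
  then show ?case
    unfolding sum_choose_Suc using Suc by (simp del: power_Suc)
qed simp

lemma sum_choose_div_recurrence:
  fixes v :: "nat \<Rightarrow> 'a::field_char_0"
  assumes rec: "\<And>j. v (j + 2) = L * v (j + 1) - v j"
  shows "(\<Sum>k\<le>n. of_nat (n choose k) * (1 / (of_nat k + 2)) * (-1) ^ k * L ^ (n - k) * v (n + k + 4))
    = 1 / ((of_nat n + 1) * (of_nat n + 2)) * (L ^ (n + 2) * v (n + 2) - v 0)
      - 1 / (of_nat n + 1) * v 2"
proof -
  define N where "N = Suc (Suc n)"
  define f where "f j = (-1) ^ j * L ^ (N - j) * v (N + j)" for j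
  define h where "h j = (of_nat j - 1) * of_nat (N choose j) * f j" for j
  have nz: "of_nat n + 1 \<noteq> (0::'a)" "of_nat n + 2 \<noteq> (0::'a)" "of_nat k + 2 \<noteq> (0::'a)" for k
    using of_nat_neq_0[of n, where 'a='a] of_nat_neq_0[of "Suc n", where 'a='a]
      of_nat_neq_0[of "Suc k", where 'a='a] by (simp_all add: add.commute)
  have plain: "(\<Sum>j\<le>N. of_nat (N choose j) * f j) = v 0"
    using sum_choose_recurrence[of v L N 0, OF rec] by (simp add: f_def)
  \<comment> \<open>Shifting \<open>j\<close> flips the sign, and
    \<open>N + Suc j = 2 + Suc n + j\<close> places the sum at offset \<open>2\<close>.\<close>
  have "(\<Sum>j\<le>Suc n. of_nat (Suc n choose j) * f (Suc j))
      = - (\<Sum>j\<le>Suc n. of_nat (Suc n choose j)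
          * ((-1) ^ j * L ^ (Suc n - j) * v (2 + Suc n + j)))"
    by (simp add: f_def N_def sum_negf[symmetric] del: binomial_Suc_Suc sum.atMost_Suc)
  also have "\<dots> = - v 2"
    using sum_choose_recurrence[of v L "Suc n" 2, OF rec] by simp
  finally have weighted: "(\<Sum>j\<le>N. of_nat j * of_nat (N choose j) * f j) = - of_nat N * v 2"
    unfolding N_def sum_index_choose_Suc by (simp add: algebra_simps)
  have "(\<Sum>j\<le>N. h j) = - of_nat N * v 2 - v 0"
    unfolding h_def plain[symmetric] weighted[symmetric]
    by (simp add: sum_subtractf[symmetric] algebra_simps)
  moreover have "(\<Sum>j\<le>N. h j) = - (L ^ N * v N) + (\<Sum>k\<le>n. h (Suc (Suc k)))"
    unfolding N_def sum.atMost_Suc_shift by (simp add: h_def f_def N_def)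
  ultimately have total: "(\<Sum>k\<le>n. h (Suc (Suc k))) = L ^ N * v N - v 0 - of_nat N * v 2"
    by (simp add: algebra_simps)
  have "of_nat (n choose k) * (1 / (of_nat k + 2)) * (-1) ^ k * L ^ (n - k) * v (n + k + 4)
      = 1 / ((of_nat n + 1) * (of_nat n + 2)) * h (Suc (Suc k))" for k
  proof -
    \<comment> \<open>Absorption is applied twice, from \<open>N\<close> down to
      \<open>n\<close>.\<close>
    have "Suc (Suc k) * (Suc k * (N choose Suc (Suc k))) = Suc (Suc n) * (Suc n * (n choose k))"
      unfolding N_def by (metis Suc_times_binomial_eq mult.assoc mult.commute)
    then have "of_nat (Suc (Suc k) * (Suc k * (N choose Suc (Suc k))))
        = (of_nat (Suc (Suc n) * (Suc n * (n choose k))) :: 'a)"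
      by (rule arg_cong)
    then have "(of_nat k + 2) * ((of_nat k + 1) * of_nat (N choose Suc (Suc k)))
        = (of_nat n + 2) * ((of_nat n + 1) * (of_nat (n choose k) :: 'a))"
      by (simp only: of_nat_mult of_nat_Suc) (simp add: algebra_simps)
    then have "of_nat (n choose k) * (1 / (of_nat k + 2))
        = 1 / ((of_nat n + 1) * (of_nat n + 2))
          * ((of_nat k + 1) * (of_nat (N choose Suc (Suc k)) :: 'a))"
      using nz by (simp add: divide_simps) (simp add: ac_simps)
    moreover have "f (Suc (Suc k)) = (-1) ^ k * L ^ (n - k) * v (n + k + 4)"
      by (simp add: f_def N_def numeral_eq_Suc)
    ultimately show ?thesis
      by (simp add: h_def ac_simps)
  qed
  then have "(\<Sum>k\<le>n. of_nat (n choose k) * (1 / (of_nat k + 2)) * (-1) ^ k * L ^ (n - k)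
        * v (n + k + 4))
      = 1 / ((of_nat n + 1) * (of_nat n + 2)) * (L ^ N * v N - v 0 - of_nat N * v 2)"
    unfolding total[symmetric] sum_distrib_left by simp
  also have "\<dots> = 1 / ((of_nat n + 1) * (of_nat n + 2)) * (L ^ N * v N - v 0)
      - 1 / (of_nat n + 1) * v 2"
  proof -
    have N: "of_nat N = of_nat n + (2::'a)"
      by (simp add: N_def)
    show ?thesis
      unfolding N using nz(1,2) by (simp add: right_diff_distrib)
  qed
  finally show ?thesis
    by (simp add: N_def numeral_2_eq_2)
qed

text \<open>Both sides obey the Fibonacci recurrence in \<open>n\<close>: the alternating sign
  compensates for running \<open>G\<close> downwards. \<open>fib.induct\<close> serves as two-step
  induction.\<close>

lemma lucas_int_of_nat_mult:
  fixes G :: "int \<Rightarrow> int"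
  assumes rec: "\<And>m. G m = G (m - 1) + G (m - 2)"
  shows "G (m + int n) + (-1) ^ n * G (m - int n) = lucas_int (int n) * G m"
proof (induction n rule: fib.induct)
  case 2
  show ?case
    using rec[of "m + 1"] by simp
next
  case (3 n)
  have "G (m + int (Suc (Suc n))) = G (m + int (Suc n)) + G (m + int n)"
    using rec[of "m + int (Suc (Suc n))"] by (simp add: algebra_simps)
  moreover have "G (m - int n) = G (m - int (Suc n)) + G (m - int (Suc (Suc n)))"
    using rec[of "m - int n"] by (simp add: algebra_simps)
  moreover have "lucas_int (int (Suc (Suc n))) = lucas_int (int (Suc n)) + lucas_int (int n)"
    using lucas_int_rec[of "int (Suc (Suc n))"] by simp
  ultimately show ?case
    using 3 by (simp add: algebra_simps)
qed simp

text \<open>For even \<open>s\<close> the sign disappears, and both sides are unchanged under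
  \<open>s\<close> to \<open>- s\<close>.\<close>

lemma lucas_int_even_mult:
  fixes G :: "int \<Rightarrow> int"
  assumes rec: "\<And>m. G m = G (m - 1) + G (m - 2)" and "even s"
  shows "G (m + s) + G (m - s) = lucas_int s * G m"
proof (cases s rule: int_cases2)
  case (nonneg n)
  then show ?thesis
    using lucas_int_of_nat_mult[of G m n, OF rec] \<open>even s\<close> by simp
next
  case (nonpos n)
  then show ?thesis
    using lucas_int_of_nat_mult[of G m n, OF rec] \<open>even s\<close>
    by (simp add: lucas_int_uminus_of_nat add.commute)
qed

lemma sum_choose_div_lucas_int:
  fixes G :: "int \<Rightarrow> int"
  assumes rec: "\<And>m. G m = G (m - 1) + G (m - 2)" and "even s"
  shows "(\<Sum>k=0..n. real (n choose k) * (1 / (real k + 2)) * (-1) ^ k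
            * real_of_int (lucas_int s) ^ (n - k)
            * real_of_int (G (2 * s * (int k + 2) + s * (int n - int k) + t)))
         = 1 / ((real n + 1) * (real n + 2))
             * (real_of_int (lucas_int s) ^ (n + 2) * real_of_int (G (s * (int n + 2) + t))
                - real_of_int (G t))
           - 1 / (real n + 1) * real_of_int (G (2 * s + t))"
proof -
  define v where "v j = real_of_int (G (s * int j + t))" for j
  have "v (j + 2) = real_of_int (lucas_int s) * v (j + 1) - v j" for j
  proof -
    \<comment> \<open>The identity is centred at the middle of three successive terms of the
      progression.\<close>
    have "G (s * int (j + 2) + t) + G (s * int j + t) = lucas_int s * G (s * int (j + 1) + t)"
      using lucas_int_even_mult[of G s "s * int (j + 1) + t", OF assms] by (simp add: algebra_simps)
    then have "G (s * int (j + 2) + t)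
        = lucas_int s * G (s * int (j + 1) + t) - G (s * int j + t)"
      by linarith
    then show ?thesis
      unfolding v_def by (metis of_int_diff of_int_mult)
  qed
  \<comment> \<open>The indices agree:
    \<open>2 * s * (k + 2) + s * (n - k) = s * (n + k + 4)\<close>.\<close>
  from sum_choose_div_recurrence[of v, OF this, of n] show ?thesis
    by (simp add: v_def atLeast0AtMost algebra_simps)
qed

theorem theorem13:
  fixes s t :: int and n :: nat
  assumes "even s"
  shows "(\<Sum>k=0..n. real (n choose k) * (1 / (real k + 2)) * (-1) ^ k
            * real_of_int (lucas_int s) ^ (n - k)
            * real_of_int (fib_int (2 * s * (int k + 2) + s * (int n - int k) + t)))
         = 1 / ((real n + 1) * (real n + 2))
             * (real_of_int (lucas_int s) ^ (n + 2) * real_of_int (fib_int (s * (int n + 2) + t))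
                - real_of_int (fib_int t))
           - 1 / (real n + 1) * real_of_int (fib_int (2 * s + t))
       \<and> (\<Sum>k=0..n. real (n choose k) * (1 / (real k + 2)) * (-1) ^ k
            * real_of_int (lucas_int s) ^ (n - k)
            * real_of_int (lucas_int (2 * s * (int k + 2) + s * (int n - int k) + t)))
         = 1 / ((real n + 1) * (real n + 2))
             * (real_of_int (lucas_int s) ^ (n + 2) * real_of_int (lucas_int (s * (int n + 2) + t))
                - real_of_int (lucas_int t))
           - 1 / (real n + 1) * real_of_int (lucas_int (2 * s + t))"
  using sum_choose_div_lucas_int[OF fib_int_rec assms]
    sum_choose_div_lucas_int[OF lucas_int_rec assms] by blast

end
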